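(* There exist an $\mathcal{ALCQ}$ concept $C_0$ and a signature $\Sigma$ such that, for every $n$, there is no $(\Sigma,n)$-uniform $\mathcal{ALC}$ interpolant of $C_0$ (under the empty ontology) of size smaller than $\mathrm{Tower}(n-2)$.
   Context: $\mathcal{ALCQ}$ concepts are built by $C,D ::= \top \mid A \mid \neg C \mid C\sqcap D \mid (\geq n\ r.C)$ with $A$ a concept name, $r$ a role name, $n\ge 0$, with standard semantics ($(\geq n\ r.C)$ holds at $d$ iff $d$ has at least $n$ $r$-successors in $C$); $\exists r.C$ abbreviates $(\geq 1\ r.C)$ and $\mathcal{ALC}$ concepts are those in which only $\exists r.C$ is used. A signature is a set $\Sigma$ of concept and role names; an $\mathcal{ALC}(\Sigma)$ concept uses only names from $\Sigma$. The role depth of a concept is the maximal nesting depth of $(\geq n\ r.C)$; the size of a concept is the number of symbols needed to write it. $\models C\sqsubseteq D$ means $C^{\mathcal{I}}\subseteq D^{\mathcal{I}}$ in every interpretation. A $(\Sigma,n)$-uniform $\mathcal{ALC}$ interpolant of $C_0$ is an $\mathcal{ALC}(\Sigma)$ concept $U$ with $\models C_0\sqsubseteq U$ and $\models U\sqsubseteq E$ for every $\mathcal{ALC}(\Sigma)$ concept $E$ of role depth at most $n$ with $\models C_0\sqsubseteq E$. $\mathrm{Tower}(0)=1$, $\mathrm{Tower}(n+1)=2^{\mathrm{Tower}(n)}$. *)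

theory Defs
  imports Main "HOL-Library.Countable_Set"
begin

type_synonym cname = nat
type_synonym rname = nat

datatype concept =
    Top
  | CName cname
  | Neg concept
  | Conj concept concept
  | AtLeast nat rname concept

(* The existential restriction "exists r.C" is AtLeast 1 r C. *)
fun alc :: "concept \<Rightarrow> bool" where
  "alc Top \<longleftrightarrow> True"
| "alc (CName A) \<longleftrightarrow> True"
| "alc (Neg C) \<longleftrightarrow> alc C"
| "alc (Conj C D) \<longleftrightarrow> alc C \<and> alc D"
| "alc (AtLeast k r C) \<longleftrightarrow> k = 1 \<and> alc C"

datatype symbol = CSym cname | RSym rname

fun sig :: "concept \<Rightarrow> symbol set" where
  "sig Top = {}"
| "sig (CName A) = {CSym A}"
| "sig (Neg C) = sig C"
| "sig (Conj C D) = sig C \<union> sig D"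
| "sig (AtLeast k r C) = insert (RSym r) (sig C)"

fun role_depth :: "concept \<Rightarrow> nat" where
  "role_depth Top = 0"
| "role_depth (CName A) = 0"
| "role_depth (Neg C) = role_depth C"
| "role_depth (Conj C D) = max (role_depth C) (role_depth D)"
| "role_depth (AtLeast k r C) = Suc (role_depth C)"

(* Every name and every constructor counts as one symbol; parentheses and dots are
   not counted. A quantifier contributes two symbols, itself (including its numeral)
   and the role name, so on ALC concepts this is the length of the notation with the
   abbreviation "exists r.C". Counting numerals or punctuation as well could only
   enlarge sizes. *)
fun csize :: "concept \<Rightarrow> nat" where
  "csize Top = 1"
| "csize (CName A) = 1"
| "csize (Neg C) = 1 + csize C"
| "csize (Conj C D) = 1 + csize C + csize D"
| "csize (AtLeast k r C) = 2 + csize C"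

record 'd interp =
  dom :: "'d set"
  cext :: "cname \<Rightarrow> 'd set"
  rext :: "rname \<Rightarrow> ('d \<times> 'd) set"

definition wf_interp :: "'d interp \<Rightarrow> bool" where
  "wf_interp I \<longleftrightarrow> dom I \<noteq> {} \<and> (\<forall>A. cext I A \<subseteq> dom I) \<and> (\<forall>r. rext I r \<subseteq> dom I \<times> dom I)"

(* The explicit finite witness set S keeps AtLeast correct at elements with
   infinitely many successors, where card would return 0. *)
fun ext :: "'d interp \<Rightarrow> concept \<Rightarrow> 'd set" where
  "ext I Top = dom I"
| "ext I (CName A) = cext I A"
| "ext I (Neg C) = dom I - ext I C"
| "ext I (Conj C D) = ext I C \<inter> ext I D"
| "ext I (AtLeast k r C) =
     {d \<in> dom I. \<exists>S. finite S \<and> card S = k \<and> S \<subseteq> {e. (d, e) \<in> rext I r} \<inter> ext I C}"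

(* A definition cannot quantify over all types, so domains here range over the
   nonempty subsets of nat. By subsumed_all_interps below (downward
   Loewenheim-Skolem), it is the same as inclusion in all interpretations over all types. *)
definition subsumed :: "concept \<Rightarrow> concept \<Rightarrow> bool" where
  "subsumed C D \<longleftrightarrow> (\<forall>I :: nat interp. wf_interp I \<longrightarrow> ext I C \<subseteq> ext I D)"

definition uniform_alc_interpolant :: "symbol set \<Rightarrow> nat \<Rightarrow> concept \<Rightarrow> concept \<Rightarrow> bool" where
  "uniform_alc_interpolant \<Sigma> n C\<^sub>0 U \<longleftrightarrow>
     alc U \<and> sig U \<subseteq> \<Sigma> \<and> subsumed C\<^sub>0 U \<and>
     (\<forall>E. alc E \<and> sig E \<subseteq> \<Sigma> \<and> role_depth E \<le> n \<and> subsumed C\<^sub>0 E \<longrightarrow> subsumed U E)"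

fun Tower :: "nat \<Rightarrow> nat" where
  "Tower 0 = 1"
| "Tower (Suc n) = 2 ^ Tower n"

instance concept :: countable
  by countable_datatype

lemma ext_subset_dom: "wf_interp I \<Longrightarrow> ext I C \<subseteq> dom I"
  by (induction C) (auto simp: wf_interp_def)

lemma countable_closed_subset:
  fixes I :: "'d interp"
  assumes "wf_interp I" and "d \<in> dom I"
  obtains X where "d \<in> X" "countable X" "X \<subseteq> dom I"
    "\<And>e k r E. e \<in> X \<Longrightarrow> e \<in> ext I (AtLeast k r E) \<Longrightarrow>
       \<exists>S. finite S \<and> card S = k \<and> S \<subseteq> {e'. (e, e') \<in> rext I r} \<inter> ext I E \<and> S \<subseteq> X"
proof -
  define P where "P = (\<lambda>(e, k, r, E) S. finite S \<and> card S = k \<and>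
    S \<subseteq> {e'. (e, e') \<in> rext I r} \<inter> ext I E)"
  define w where "w t = (if \<exists>S. P t S then SOME S. P t S else {})" for t
  have w: "P t (w t)" if "\<exists>S. P t S" for t
    using someI_ex[OF that] that by (simp add: w_def)
  have fin: "finite (w t)" for t
    using w[of t] by (cases "\<exists>S. P t S") (auto simp: w_def P_def split: prod.splits)
  have sub: "w t \<subseteq> dom I" for t
    using w[of t] ext_subset_dom[OF assms(1)]
    by (cases "\<exists>S. P t S") (fastforce simp: w_def P_def split: prod.splits)+
  define step where "step Y = Y \<union> (\<Union>e\<in>Y. \<Union>t. w (e, t))" for Y
  define X where "X = (\<Union>i. (step ^^ i) {d})"
  have "countable (step Y)" if "countable Y" for Y
    unfolding step_def by (intro countable_Un countable_UN countable_finite[OF fin] that) auto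
  then have c: "countable ((step ^^ i) {d})" for i
    by (induction i) auto
  have "step Y \<subseteq> dom I" if "Y \<subseteq> dom I" for Y
    unfolding step_def by (intro Un_least UN_least sub that)
  then have s: "(step ^^ i) {d} \<subseteq> dom I" for i
    using assms(2) by (induction i) auto
  show thesis
  proof
    show "d \<in> X" unfolding X_def by (rule UN_I[of 0]) auto
    show "countable X" using c by (auto simp: X_def)
    show "X \<subseteq> dom I" using s by (auto simp: X_def)
    fix e k r E assume e: "e \<in> X" and "e \<in> ext I (AtLeast k r E)"
    then have "\<exists>S. P (e, k, r, E) S" by (auto simp: P_def)
    from w[OF this] have P: "P (e, k, r, E) (w (e, k, r, E))" .
    obtain i where i: "e \<in> (step ^^ i) {d}" using e by (auto simp: X_def)
    have "w (e, k, r, E) \<subseteq> (step ^^ Suc i) {d}"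
      using i by (auto simp: step_def)
    then have "w (e, k, r, E) \<subseteq> X" unfolding X_def by blast
    with P show "\<exists>S. finite S \<and> card S = k \<and>
        S \<subseteq> {e'. (e, e') \<in> rext I r} \<inter> ext I E \<and> S \<subseteq> X"
      by (auto simp: P_def)
  qed
qed

lemma subsumed_all_interps:
  fixes I :: "'d interp"
  assumes "subsumed C D" and I: "wf_interp I"
  shows "ext I C \<subseteq> ext I D"
proof
  fix d assume d: "d \<in> ext I C"
  then have "d \<in> dom I" using ext_subset_dom[OF I] by blast
  from countable_closed_subset[OF I this] obtain X where
    dX: "d \<in> X" and cX: "countable X" and XI: "X \<subseteq> dom I" and
    cl: "\<And>e k r E. e \<in> X \<Longrightarrow> e \<in> ext I (AtLeast k r E) \<Longrightarrow>
       \<exists>S. finite S \<and> card S = k \<and> S \<subseteq> {e'. (e, e') \<in> rext I r} \<inter> ext I E \<and> S \<subseteq> X"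
    by blast
  define f where "f = to_nat_on X"
  have inj: "inj_on f X" using cX unfolding f_def by (rule inj_on_to_nat_on)
  define J where "J = \<lparr>dom = f ` X, cext = (\<lambda>A. f ` (cext I A \<inter> X)),
    rext = (\<lambda>r. map_prod f f ` (rext I r \<inter> X \<times> X))\<rparr>"
  have J: "wf_interp J" using dX by (auto simp: wf_interp_def J_def)
  have iff: "f e \<in> ext J E \<longleftrightarrow> e \<in> ext I E" if "e \<in> X" for e E
    using that
  proof (induction E arbitrary: e)
    case Top
    then show ?case using XI by (auto simp: J_def)
  next
    case (CName A)
    then show ?case using inj by (auto simp: J_def dest: inj_onD)
  next
    case (Neg E)
    then show ?case using XI by (auto simp: J_def)
  next
    case (Conj E F)
    then show ?case by simp
  next
    case (AtLeast k r E)
    have succ: "(f e, f e') \<in> rext J r \<longleftrightarrow> (e, e') \<in> rext I r" if "e' \<in> X" for e'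
      using AtLeast.prems that inj by (auto simp: J_def dest: inj_onD)
    show ?case
    proof
      assume "f e \<in> ext J (AtLeast k r E)"
      then obtain S where S: "finite S" "card S = k"
        "S \<subseteq> {y. (f e, y) \<in> rext J r} \<inter> ext J E" by auto
      have "S \<subseteq> f ` X" using S(3) ext_subset_dom[OF J, of E] by (auto simp: J_def)
      then obtain T where T: "T \<subseteq> X" "S = f ` T" by (auto simp: subset_image_iff)
      have "inj_on f T" using inj T(1) by (rule inj_on_subset)
      then have "finite T" "card T = k" using S T by (auto simp: card_image dest: finite_imageD)
      moreover have "T \<subseteq> {y. (e, y) \<in> rext I r} \<inter> ext I E"
        using S(3) T succ AtLeast.IH by blast
      ultimately show "e \<in> ext I (AtLeast k r E)" using AtLeast.prems XI by auto
    next
      assume "e \<in> ext I (AtLeast k r E)"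
      from cl[OF AtLeast.prems this] obtain S where S: "finite S" "card S = k"
        "S \<subseteq> {y. (e, y) \<in> rext I r} \<inter> ext I E" "S \<subseteq> X" by blast
      have "card (f ` S) = k" using S inj_on_subset[OF inj S(4)] by (simp add: card_image)
      moreover have "f ` S \<subseteq> {y. (f e, y) \<in> rext J r} \<inter> ext J E"
        using S succ AtLeast.IH by blast
      moreover have "f e \<in> dom J" using AtLeast.prems by (simp add: J_def)
      ultimately show "f e \<in> ext J (AtLeast k r E)" using S(1) by auto
    qed
  qed
  from d dX iff have "f d \<in> ext J C" by blast
  with assms(1) J have "f d \<in> ext J D" by (auto simp: subsumed_def)
  with dX iff show "d \<in> ext I D" by blast
qed


end

theory Submission
  imports Defs "HOL-Library.Nat_Bijection"
begin

text \<open>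
  Take \<open>C\<^sub>0 = (\<le> 1 r.\<top>)\<close> and \<open>\<Sigma> = {r}\<close>. A \<open>(\<Sigma>,n)\<close>-uniform interpolant has to say that all
  \<open>r\<close>-successors satisfy the same \<open>\<Sigma>\<close>-concepts of role depth at most \<open>n - 1\<close>. In the universe of
  hereditarily finite sets, with the successors of a set being its elements, the sets of rank at
  most \<open>n - 1\<close> are pairwise distinguishable by such concepts, and there are \<open>Tower (n - 1)\<close> of
  them. An \<open>\<A>\<L>\<C>\<close> concept \<open>U\<close> sees its successors only through the arguments of its outermost
  restrictions. If there are fewer than \<open>Tower (n - 2)\<close> of these, two distinct sets \<open>x\<close>, \<open>y\<close> of
  rank at most \<open>n - 1\<close> look the same, so \<open>U\<close> cannot separate \<open>{x}\<close> from \<open>{x, y}\<close>.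
\<close>

abbreviation Exists :: "rname \<Rightarrow> concept \<Rightarrow> concept" where
  "Exists \<equiv> AtLeast (Suc 0)"

lemma mem_ext_Exists:
  "d \<in> ext I (Exists r C) \<longleftrightarrow> d \<in> dom I \<and> (\<exists>e \<in> ext I C. (d, e) \<in> rext I r)"
proof -
  have "(\<exists>S. finite S \<and> card S = Suc 0 \<and> S \<subseteq> X) \<longleftrightarrow> X \<noteq> {}" for X :: "'a set"
    by (auto simp: card_Suc_eq)
  from this[of "{e. (d, e) \<in> rext I r} \<inter> ext I C"] show ?thesis by auto
qed

text \<open>A successor in \<open>X\<close> and one outside \<open>X\<close> would be two distinct
  successors.\<close>

lemma at_most_one_subsumed:
  "subsumed (Neg (AtLeast 2 r Top)) (Neg (Conj (Exists r X) (Exists r (Neg X))))"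
  unfolding subsumed_def
proof (intro allI impI subsetI)
  fix I :: "nat interp" and d
  assume I: "wf_interp I" and d: "d \<in> ext I (Neg (AtLeast 2 r Top))"
  show "d \<in> ext I (Neg (Conj (Exists r X) (Exists r (Neg X))))"
  proof (rule ccontr)
    assume "\<not> ?thesis"
    then have "d \<in> ext I (Exists r X)" "d \<in> ext I (Exists r (Neg X))" using d by auto
    then obtain x y where "x \<in> ext I X" "y \<in> ext I (Neg X)" "(d, x) \<in> rext I r" "(d, y) \<in> rext I r"
      unfolding mem_ext_Exists by blast
    moreover from this have "x \<noteq> y" by auto
    ultimately have "finite {x, y} \<and> card {x, y} = 2 \<and> {x, y} \<subseteq> {e. (d, e) \<in> rext I r} \<inter> ext I Top"
      using ext_subset_dom[OF I, of X] by auto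
    then have "\<exists>S. finite S \<and> card S = 2 \<and> S \<subseteq> {e. (d, e) \<in> rext I r} \<inter> ext I Top" by (rule exI)
    then have "d \<in> ext I (AtLeast 2 r Top)" using d by simp
    then show False using d by simp
  qed
qed

text \<open>Hereditarily finite sets in Ackermann's encoding; those below \<open>Tower k\<close> are the sets of rank
  at most \<open>k\<close>.\<close>

definition hf :: "nat interp" where
  "hf = \<lparr>dom = UNIV, cext = (\<lambda>_. {}), rext = (\<lambda>_. {(x, y). y \<in> set_decode x})\<rparr>"

lemma hf_simps [simp]: "dom hf = UNIV" "(x, y) \<in> rext hf r \<longleftrightarrow> y \<in> set_decode x"
  by (simp_all add: hf_def)

lemma wf_hf: "wf_interp hf"
  by (simp add: wf_interp_def hf_def)

lemma set_decode_less: "x < 2 ^ m \<Longrightarrow> y \<in> set_decode x \<Longrightarrow> y < m"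
  by (metis bit_iff_odd bit_take_bit_iff set_decode_def mem_Collect_eq take_bit_nat_eq_self)

text \<open>Describes \<open>x\<close> among the sets of rank at most \<open>k\<close>.
  \<open>Top\<close> suffices at level 0, where the empty set is the only one.\<close>

fun char_concept :: "nat \<Rightarrow> nat \<Rightarrow> concept" where
  "char_concept 0 x = Top"
| "char_concept (Suc k) x = foldr
     (\<lambda>z. Conj (if z \<in> set_decode x then Exists 0 (char_concept k z)
                else Neg (Exists 0 (char_concept k z))))
     [0..<Tower k] Top"

lemma alc_foldr_Conj: "alc (foldr (\<lambda>z. Conj (f z)) zs Top) \<longleftrightarrow> (\<forall>z \<in> set zs. alc (f z))"
  by (induction zs) auto

lemma sig_foldr_Conj: "sig (foldr (\<lambda>z. Conj (f z)) zs Top) = (\<Union>z \<in> set zs. sig (f z))"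
  by (induction zs) auto

lemma role_depth_foldr_Conj:
  "role_depth (foldr (\<lambda>z. Conj (f z)) zs Top) \<le> m \<longleftrightarrow> (\<forall>z \<in> set zs. role_depth (f z) \<le> m)"
  by (induction zs) auto

lemma mem_ext_foldr_Conj:
  "d \<in> ext I (foldr (\<lambda>z. Conj (f z)) zs Top) \<longleftrightarrow> d \<in> dom I \<and> (\<forall>z \<in> set zs. d \<in> ext I (f z))"
  by (induction zs) auto

lemma alc_char_concept: "alc (char_concept k x)"
  by (induction k arbitrary: x) (auto simp: alc_foldr_Conj)

lemma sig_char_concept: "sig (char_concept k x) \<subseteq> {RSym 0}"
  by (induction k arbitrary: x) (fastforce simp: sig_foldr_Conj split: if_splits)+

lemma role_depth_char_concept: "role_depth (char_concept k x) \<le> k"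
  by (induction k arbitrary: x) (auto simp: role_depth_foldr_Conj)

text \<open>This is extensionality: by induction each conjunct decides the membership of one
  \<open>z < Tower k\<close>, and all elements of \<open>x\<close> and \<open>y\<close> lie below
  that bound.\<close>

lemma mem_ext_char_concept:
  "x < Tower k \<Longrightarrow> y < Tower k \<Longrightarrow> y \<in> ext hf (char_concept k x) \<longleftrightarrow> y = x"
proof (induction k arbitrary: x y)
  case 0
  then show ?case by simp
next
  case (Suc k)
  have bound: "z < Tower k" if "z \<in> set_decode x \<union> set_decode y" for z
    using that Suc.prems set_decode_less[of _ "Tower k"] by auto
  have "y \<in> ext hf (Exists 0 (char_concept k z)) \<longleftrightarrow> z \<in> set_decode y" if "z < Tower k" for z
    unfolding mem_ext_Exists using Suc.IH[OF that] that bound by auto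
  then have "y \<in> ext hf (char_concept (Suc k) x) \<longleftrightarrow>
      (\<forall>z < Tower k. z \<in> set_decode x \<longleftrightarrow> z \<in> set_decode y)"
    by (simp add: mem_ext_foldr_Conj del: ext.simps(5)) (auto simp del: ext.simps(5))
  also have "\<dots> \<longleftrightarrow> set_decode x = set_decode y" using bound by blast
  also have "\<dots> \<longleftrightarrow> y = x" by (metis set_decode_inverse)
  finally show ?case .
qed

fun outer_args :: "concept \<Rightarrow> concept set" where
  "outer_args Top = {}"
| "outer_args (CName A) = {}"
| "outer_args (Neg C) = outer_args C"
| "outer_args (Conj C D) = outer_args C \<union> outer_args D"
| "outer_args (AtLeast k r C) = {C}"

lemma finite_outer_args: "finite (outer_args C)"
  by (induction C) auto

lemma card_outer_args: "card (outer_args C) \<le> csize C"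
proof (induction C)
  case (Conj C D)
  then show ?case using card_Un_le[of "outer_args C" "outer_args D"] by simp
qed auto

text \<open>Restrictions in \<open>U\<close> only ask whether some successor lies in
  \<open>C\<close>, and \<open>y\<close> adds no new answer to that of \<open>x\<close>. Numbers
  above 1 could count the successors; \<open>alc U\<close> excludes them.\<close>

lemma hf_indistinguishable:
  assumes "set_decode a = {x}" and "set_decode b = {x, y}"
    and "alc U" and "\<And>C. C \<in> outer_args U \<Longrightarrow> x \<in> ext hf C \<longleftrightarrow> y \<in> ext hf C"
  shows "a \<in> ext hf U \<longleftrightarrow> b \<in> ext hf U"
  using assms(3,4)
proof (induction U)
  case (AtLeast k r C)
  then have "k = Suc 0" by simp
  with AtLeast.prems(2)[of C] show ?case
    by (simp add: mem_ext_Exists assms(1,2) conj_disj_distribL ex_disj_distrib del: ext.simps(5))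
      (auto simp del: ext.simps(5))
qed (auto simp: hf_def)

theorem theorem3:
  "\<exists>(C\<^sub>0 :: concept) (\<Sigma> :: symbol set). finite \<Sigma> \<and>
     (\<forall>n. \<not> (\<exists>U. uniform_alc_interpolant \<Sigma> n C\<^sub>0 U \<and> csize U < Tower (n - 2)))"
proof (intro exI conjI allI notI)
  show "finite {RSym 0}" by simp
  fix n
  assume "\<exists>U. uniform_alc_interpolant {RSym 0} n (Neg (AtLeast 2 0 Top)) U \<and> csize U < Tower (n - 2)"
  then obtain U where U: "uniform_alc_interpolant {RSym 0} n (Neg (AtLeast 2 0 Top)) U"
    and small: "csize U < Tower (n - 2)" by blast
  \<comment> \<open>For \<open>n \<le> 2\<close> truncated subtraction makes the bound
    \<open>Tower 0 = 1\<close>, below which there is no size.\<close>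
  have "csize U > 0" by (cases U) auto
  with small have "n - 2 \<noteq> 0" by (cases "n - 2 = 0") auto
  then have "n = Suc (Suc (n - 2))" by arith
  then obtain m where n: "n = Suc (Suc m)" by blast
  \<comment> \<open>Here \<open>k = n - 1\<close>, since \<open>E\<close> below nests one
    restriction around a concept of depth at most \<open>k\<close>.\<close>
  define k where "k = Suc m"
  define profile where "profile x = {C \<in> outer_args U. x \<in> ext hf C}" for x
  have "card (profile ` {..<Tower k}) \<le> card (Pow (outer_args U))"
    by (rule card_mono) (auto simp: profile_def finite_outer_args)
  also have "\<dots> = 2 ^ card (outer_args U)" by (simp add: card_Pow finite_outer_args)
  \<comment> \<open>Pigeonhole: fewer than \<open>2 ^ Tower m = Tower k\<close> profiles.\<close>
  also have "\<dots> < Tower k" using card_outer_args[of U] small by (simp add: n k_def)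
  finally have "\<not> inj_on profile {..<Tower k}" using card_image by fastforce
  then obtain x y where xy: "x < Tower k" "y < Tower k" "x \<noteq> y" "profile x = profile y"
    by (auto simp: inj_on_def)

  obtain a b where a: "set_decode a = {x}" and b: "set_decode b = {x, y}"
    by (meson finite.emptyI finite.insertI set_encode_inverse)
  define X where "X = char_concept k x"
  define E where "E = Neg (Conj (Exists 0 X) (Exists 0 (Neg X)))"
  have "alc E" "sig E \<subseteq> {RSym 0}" "role_depth E \<le> n"
    using alc_char_concept[of k x] sig_char_concept[of k x] role_depth_char_concept[of k x]
    by (auto simp: E_def X_def n k_def)
  then have "subsumed U E"
    using U at_most_one_subsumed[of 0 X] by (simp add: uniform_alc_interpolant_def E_def)
  moreover have "b \<notin> ext hf E"
    using mem_ext_char_concept[of x k x] mem_ext_char_concept[of x k y] xy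
    by (auto simp: E_def X_def mem_ext_Exists b simp del: ext.simps(5))
  ultimately have "b \<notin> ext hf U" using wf_hf by (auto simp: subsumed_def)
  moreover have "a \<in> ext hf (Neg (AtLeast 2 0 Top))"
    by (auto simp: a subset_singleton_iff)
  then have "a \<in> ext hf U"
    using U wf_hf unfolding uniform_alc_interpolant_def subsumed_def by blast
  moreover have "x \<in> ext hf C \<longleftrightarrow> y \<in> ext hf C" if "C \<in> outer_args U" for C
    using xy(4) that by (auto simp: profile_def)
  ultimately show False
    using hf_indistinguishable[OF a b, of U] U by (auto simp: uniform_alc_interpolant_def)
qed

end
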